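(* For every $0<\epsilon<\frac12$ there exists a constant $C=C(\epsilon)>0$ such that the random graph $G\sim\mathcal{G}(n,p)$, where $p=C\frac{\log n}{n}$, satisfies, with probability tending to $1$ as $n\to\infty$, $$i(G)\le\left(\tfrac12+\epsilon\right)\delta(G)=\Theta(\log n).$$ Furthermore, with probability tending to $1$ as $n\to\infty$, every set $S$ of $\lfloor n/2\rfloor$ vertices of $G$ satisfies $\frac{|\partial S|}{|S|}<\left(\tfrac12+\epsilon\right)\delta(G)$.
   Context: For a graph $G=(V,E)$ and $S\subseteq V$, the edge boundary is $\partial S=\{(u,v)\in E: u\in S, v\notin S\}$, the set of edges with exactly one endpoint in $S$. The isoperimetric constant of $G$ is $i(G)=\min\{|\partial S|/|S| : \emptyset\ne S\subset V,\ |S|\le \tfrac12|V|\}$. $\delta(G)$ denotes the minimal degree of $G$. $\mathcal{G}(n,p)$ is the random graph on $n$ vertices in which each pair of distinct vertices is adjacent with probability $p$, independently of all other pairs. The assertion $(\frac12+\epsilon)\delta(G)=\Theta(\log n)$ means that, with probability tending to $1$, this quantity lies between two positive constant multiples of $\log n$ (constants depending only on $\epsilon$). All logarithms are natural. *)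

theory Defs
  imports "HOL-Probability.Probability" "HOL-Probability.Product_PMF"
begin

text \<open>A simple graph is a pair of a vertex set and a set of edges, an edge being an unordered
  pair of distinct vertices, i.e. a two-element subset of the vertex set.\<close>

type_synonym 'a ugraph = "'a set \<times> 'a set set"

abbreviation verts :: "'a ugraph \<Rightarrow> 'a set" where "verts \<equiv> fst"

abbreviation edges :: "'a ugraph \<Rightarrow> 'a set set" where "edges \<equiv> snd"

definition all_pairs :: "'a set \<Rightarrow> 'a set set" where
  "all_pairs V = {e. e \<subseteq> V \<and> card e = 2}"

definition edge_boundary :: "'a ugraph \<Rightarrow> 'a set \<Rightarrow> 'a set set" where
  "edge_boundary G S = {e \<in> edges G. \<exists>u v. e = {u, v} \<and> u \<in> S \<and> v \<notin> S}"

text \<open>The minimum is over a nonempty set only if the finite graph has at least two vertices;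
  for smaller graphs the value is unspecified.\<close>

definition isoperimetric_constant :: "'a ugraph \<Rightarrow> real" where
  "isoperimetric_constant G =
     Min {real (card (edge_boundary G S)) / real (card S) | S.
            S \<noteq> {} \<and> S \<subset> verts G \<and> real (card S) \<le> real (card (verts G)) / 2}"

definition degree :: "'a ugraph \<Rightarrow> 'a \<Rightarrow> nat" where
  "degree G v = card {e \<in> edges G. v \<in> e}"

definition min_degree :: "'a ugraph \<Rightarrow> nat" where
  "min_degree G = Min (degree G ` verts G)"

text \<open>The random graph on the vertex set \<open>{..<n}\<close>: one independent Bernoulli variable with
  parameter \<open>p\<close> for each pair of distinct vertices decides whether that pair is an edge.
  Since \<^const>\<open>bernoulli_pmf\<close> truncates its parameter to the unit interval, this is defined for
  every real \<open>p\<close>.\<close>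

definition random_graph :: "nat \<Rightarrow> real \<Rightarrow> nat ugraph pmf" where
  "random_graph n p =
     map_pmf (\<lambda>X. ({..<n}, {e \<in> all_pairs {..<n}. X e}))
       (Pi_pmf (all_pairs {..<n}) False (\<lambda>_. bernoulli_pmf p))"

end

theory Submission
  imports Defs "HOL-Real_Asymp.Real_Asymp"
begin

text \<open>
  Write \<open>p = C ln n / n\<close>.  A vertex has about \<open>n p\<close> neighbours, whereas an edge boundary of half
  of the vertices contains about \<open>(n / 2) (n / 2) p\<close> edges, that is about \<open>n p / 2\<close> per vertex of
  the half.  The ratio of the two is \<open>1 / 2\<close>, so the theorem holds as soon as the smallest degree
  and all the bisections are simultaneously within a factor \<open>1 \<mp> \<eta>\<close> of their expectations, on
  the side that matters, for some \<open>\<eta>\<close> small compared to \<open>\<epsilon>\<close>.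

  Every quantity involved is the number of edges of the random graph in a fixed set of pairs, so it
  is binomially distributed (lemma \<open>edge_count_binomial\<close>), and exceeds \<open>z\<close> times its mean \<open>m\<close>
  (or, for \<open>z < 1\<close>, falls short of it) with probability at most \<open>exp (- m h(z))\<close>, where
  \<open>h(z) = z ln z - z + 1\<close> is positive for \<open>z \<noteq> 1\<close>.
  Two union bounds have to be paid for (lemma \<open>prob_concentrated\<close>):

  \<^item> There are only \<open>n\<close> degrees, each of mean about \<open>C ln n\<close>.  All of them are large once
    \<open>n exp (- C h(1 - \<eta>) ln n)\<close> tends to \<open>0\<close>, and this is what decides how large \<open>C\<close> must be.

  \<^item> There are up to \<open>2 ^ n\<close> bisections, but the mean size of each is of order \<open>n ln n\<close>, so that
    the failure probability beats \<open>2 ^ n\<close> whatever the constant.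

  An upper bound of order \<open>ln n\<close> on the minimal degree needs no union bound, since the degree of a
  single vertex bounds it.  The inequality for the isoperimetric constant comes from a single
  bisection.
\<close>

section \<open>Tails of the binomial distribution\<close>

text \<open>
  The relative entropy between Poisson distributions of means \<open>z\<close> and \<open>1\<close>, which is the exponential
  rate at which a sum of rare independent events deviates from its mean by the factor \<open>z\<close>.
\<close>

definition rel_entropy :: "real \<Rightarrow> real" where
  "rel_entropy z = z * ln z - z + 1"

lemma rel_entropy_pos:
  assumes "0 < z" "z \<noteq> 1"
  shows "0 < rel_entropy z"
proof -
  have "ln (1 / z) \<le> 1 / z - 1" using assms by (intro ln_le_minus_one) auto
  moreover have "ln (1 / z) \<noteq> 1 / z - 1"
    using assms ln_eq_minus_one[of "1 / z"] by auto
  ultimately have "z * ln (1 / z) < z * (1 / z - 1)" using assms by simp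
  also have "z * ln (1 / z) = - (z * ln z)" using assms by (simp add: ln_div)
  finally show ?thesis using assms by (simp add: rel_entropy_def right_diff_distrib)
qed

lemma expectation_power_binomial:
  fixes p z :: real
  assumes "0 \<le> p" "p \<le> 1"
  shows "measure_pmf.expectation (binomial_pmf n p) (\<lambda>k. z ^ k) = (1 + p * (z - 1)) ^ n"
proof -
  have "measure_pmf.expectation (binomial_pmf n p) (\<lambda>k. z ^ k)
      = (\<Sum>k\<le>n. z ^ k * pmf (binomial_pmf n p) k)"
    using assms by (intro integral_measure_pmf_real) (auto simp: set_pmf_binomial_eq split: if_splits)
  also have "\<dots> = (\<Sum>k\<le>n. of_nat (n choose k) * (p * z) ^ k * (1 - p) ^ (n - k))"
    using assms by (intro sum.cong) (auto simp: power_mult_distrib)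
  also have "\<dots> = (p * z + (1 - p)) ^ n" by (simp add: binomial_ring)
  finally show ?thesis by (simp add: algebra_simps)
qed

text \<open>
  Chernoff's argument: Markov's inequality for \<open>z ^ k\<close>, whose expectation
  \<open>(1 + p (z - 1)) ^ n\<close> is at most \<open>exp (n p (z - 1))\<close>.  The base \<open>z\<close> is optimal for the deviation by
  the factor \<open>z\<close>.  The event reads \<open>k \<ge> z n p\<close> for \<open>z > 1\<close> and \<open>k \<le> z n p\<close> for
  \<open>z < 1\<close>; multiplying by \<open>ln z\<close> covers both tails with one proof.
\<close>

lemma binomial_tail:
  fixes p z :: real
  assumes p: "0 \<le> p" "p \<le> 1" and z: "0 < z"
  shows "measure_pmf.prob (binomial_pmf n p) {k. 0 \<le> (real k - z * (real n * p)) * ln z}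
    \<le> exp (- (real n * p * rel_entropy z))"
proof -
  have "measure_pmf.prob (binomial_pmf n p) {k. 0 \<le> (real k - z * (real n * p)) * ln z}
      = measure_pmf.prob (binomial_pmf n p)
          {k \<in> space (measure_pmf (binomial_pmf n p)). z ^ k \<ge> exp (z * (real n * p) * ln z)}"
  proof -
    have "z ^ k = exp (real k * ln z)" for k using z by (simp add: exp_of_nat_mult)
    thus ?thesis by (simp add: algebra_simps)
  qed
  also have "\<dots> \<le> measure_pmf.expectation (binomial_pmf n p) (\<lambda>k. z ^ k) / exp (z * (real n * p) * ln z)"
  proof (rule integral_Markov_inequality_measure)
    show "integrable (measure_pmf (binomial_pmf n p)) (\<lambda>k. z ^ k)"
      using p by (intro integrable_measure_pmf_finite) (auto simp: set_pmf_binomial_eq)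
  qed (use z in auto)
  also have "\<dots> = (1 + p * (z - 1)) ^ n / exp (z * (real n * p) * ln z)"
    using p by (simp add: expectation_power_binomial)
  also have "\<dots> \<le> exp (p * (z - 1)) ^ n / exp (z * (real n * p) * ln z)"
  proof (intro divide_right_mono power_mono)
    have "0 \<le> (1 - p) + p * z" using p z by (intro add_nonneg_nonneg mult_nonneg_nonneg) auto
    thus "0 \<le> 1 + p * (z - 1)" by (simp add: algebra_simps)
  qed (use exp_ge_add_one_self in auto)
  also have "\<dots> = exp (- (real n * p * rel_entropy z))"
    by (simp add: rel_entropy_def exp_of_nat_mult [symmetric] exp_diff [symmetric] algebra_simps)
  finally show ?thesis .
qed

lemma binomial_upper_tail:
  fixes p z :: real
  assumes "0 \<le> p" "p \<le> 1" and "1 \<le> z"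
  shows "measure_pmf.prob (binomial_pmf n p) {k. z * (real n * p) \<le> real k}
    \<le> exp (- (real n * p * rel_entropy z))"
proof -
  have "measure_pmf.prob (binomial_pmf n p) {k. z * (real n * p) \<le> real k}
    \<le> measure_pmf.prob (binomial_pmf n p) {k. 0 \<le> (real k - z * (real n * p)) * ln z}"
    using assms by (intro measure_pmf.finite_measure_mono) (auto intro!: mult_nonneg_nonneg)
  also have "\<dots> \<le> exp (- (real n * p * rel_entropy z))"
    using assms by (intro binomial_tail) auto
  finally show ?thesis .
qed

lemma binomial_lower_tail:
  fixes p z :: real
  assumes "0 \<le> p" "p \<le> 1" and "0 < z" "z \<le> 1"
  shows "measure_pmf.prob (binomial_pmf n p) {k. real k \<le> z * (real n * p)}
    \<le> exp (- (real n * p * rel_entropy z))"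
proof -
  have "measure_pmf.prob (binomial_pmf n p) {k. real k \<le> z * (real n * p)}
    \<le> measure_pmf.prob (binomial_pmf n p) {k. 0 \<le> (real k - z * (real n * p)) * ln z}"
    using assms by (intro measure_pmf.finite_measure_mono) (auto intro!: mult_nonpos_nonpos)
  also have "\<dots> \<le> exp (- (real n * p * rel_entropy z))"
    using assms by (intro binomial_tail) auto
  finally show ?thesis .
qed

section \<open>Degrees and edge boundaries as binomial edge counts\<close>

abbreviation complete_graph :: "nat \<Rightarrow> nat ugraph" where
  "complete_graph n \<equiv> ({..<n}, all_pairs {..<n})"

lemma finite_all_pairs: "finite V \<Longrightarrow> finite (all_pairs V)"
  by (rule finite_subset[of _ "Pow V"]) (auto simp: all_pairs_def)

lemma random_graph_support:
  assumes "G \<in> set_pmf (random_graph n p)"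
  shows "verts G = {..<n}" "edges G \<subseteq> all_pairs {..<n}"
  using assms by (auto simp: random_graph_def)

text \<open>
  Discarding the pairs outside \<open>F\<close> leaves \<open>card F\<close> independent Bernoulli variables, and
  the number of successes among these is binomial.
\<close>

lemma edge_count_binomial:
  assumes "0 \<le> p" "p \<le> 1" and F: "F \<subseteq> all_pairs {..<n}"
  shows "map_pmf (\<lambda>G. card (edges G \<inter> F)) (random_graph n p) = binomial_pmf (card F) p"
proof -
  let ?A = "all_pairs {..<n}"
  have fin: "finite ?A" by (simp add: finite_all_pairs)
  have "binomial_pmf (card F) p = map_pmf (\<lambda>X. card {e \<in> F. X e}) (Pi_pmf F False (\<lambda>_. bernoulli_pmf p))"
    using assms fin by (intro binomial_pmf_altdef') (auto intro: finite_subset)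
  also have "Pi_pmf F False (\<lambda>_. bernoulli_pmf p)
      = map_pmf (\<lambda>X e. if e \<in> F then X e else False) (Pi_pmf ?A False (\<lambda>_. bernoulli_pmf p))"
    using fin F by (rule Pi_pmf_subset)
  also have "map_pmf (\<lambda>X. card {e \<in> F. X e}) \<dots> = map_pmf (\<lambda>G. card (edges G \<inter> F)) (random_graph n p)"
    unfolding random_graph_def map_pmf_comp
    by (rule map_pmf_cong[OF refl], rule arg_cong[of _ _ card]) (use F in auto)
  finally show ?thesis ..
qed

lemma degree_eq_edge_count:
  assumes "edges G \<subseteq> all_pairs {..<n}"
  shows "degree G v = card (edges G \<inter> {e \<in> all_pairs {..<n}. v \<in> e})"
  unfolding degree_def by (rule arg_cong[of _ _ card]) (use assms in auto)

lemma edge_boundary_eq_inter: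
  assumes "edges G \<subseteq> all_pairs {..<n}"
  shows "edge_boundary G S = edges G \<inter> edge_boundary (complete_graph n) S"
  using assms by (auto simp: edge_boundary_def)

lemma card_incident_pairs:
  assumes "v < n"
  shows "card {e \<in> all_pairs {..<n}. v \<in> e} = n - 1"
proof -
  have "bij_betw (\<lambda>u. {v, u}) ({..<n} - {v}) {e \<in> all_pairs {..<n}. v \<in> e}"
    unfolding bij_betw_def
  proof (intro conjI equalityI subsetI)
    show "inj_on (\<lambda>u. {v, u}) ({..<n} - {v})" by (auto simp: inj_on_def doubleton_eq_iff)
  next
    fix e assume "e \<in> (\<lambda>u. {v, u}) ` ({..<n} - {v})"
    thus "e \<in> {e \<in> all_pairs {..<n}. v \<in> e}" using assms by (auto simp: all_pairs_def)
  next
    fix e assume "e \<in> {e \<in> all_pairs {..<n}. v \<in> e}"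
    thus "e \<in> (\<lambda>u. {v, u}) ` ({..<n} - {v})" by (auto simp: all_pairs_def card_2_iff)
  qed
  from bij_betw_same_card[OF this] show ?thesis using assms by simp
qed

lemma card_edge_boundary_complete_graph:
  assumes S: "S \<subseteq> {..<n}"
  shows "card (edge_boundary (complete_graph n) S) = card S * (n - card S)"
proof -
  have "bij_betw (\<lambda>(u, v). {u, v}) (S \<times> ({..<n} - S)) (edge_boundary (complete_graph n) S)"
    unfolding bij_betw_def
  proof (intro conjI equalityI subsetI)
    show "inj_on (\<lambda>(u, v). {u, v}) (S \<times> ({..<n} - S))" by (auto simp: inj_on_def doubleton_eq_iff)
  next
    fix e assume "e \<in> (\<lambda>(u, v). {u, v}) ` (S \<times> ({..<n} - S))"
    then obtain u v where uv: "u \<in> S" "v \<in> {..<n} - S" "e = {u, v}" by auto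
    hence "u \<noteq> v" by auto
    thus "e \<in> edge_boundary (complete_graph n) S"
      using uv S by (auto simp: edge_boundary_def all_pairs_def)
  next
    fix e assume "e \<in> edge_boundary (complete_graph n) S"
    thus "e \<in> (\<lambda>(u, v). {u, v}) ` (S \<times> ({..<n} - S))"
      by (force simp: edge_boundary_def all_pairs_def)
  qed
  from bij_betw_same_card[OF this] show ?thesis
    using S by (simp add: card_cartesian_product card_Diff_subset finite_subset)
qed

lemma prob_edge_count_ge:
  fixes p z :: real
  assumes "0 \<le> p" "p \<le> 1" "F \<subseteq> all_pairs {..<n}" "1 \<le> z"
  shows "measure_pmf.prob (random_graph n p) {G. z * (real (card F) * p) \<le> real (card (edges G \<inter> F))}
    \<le> exp (- (real (card F) * p * rel_entropy z))"
  using binomial_upper_tail[OF assms(1,2,4), of "card F"]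
  unfolding edge_count_binomial[OF assms(1-3), symmetric] by simp

lemma prob_edge_count_le:
  fixes p z :: real
  assumes "0 \<le> p" "p \<le> 1" "F \<subseteq> all_pairs {..<n}" "0 < z" "z \<le> 1"
  shows "measure_pmf.prob (random_graph n p) {G. real (card (edges G \<inter> F)) \<le> z * (real (card F) * p)}
    \<le> exp (- (real (card F) * p * rel_entropy z))"
  using binomial_lower_tail[OF assms(1,2,4,5), of "card F"]
  unfolding edge_count_binomial[OF assms(1-3), symmetric] by simp

section \<open>Concentration of all degrees and all bisections\<close>

text \<open>
  Each bound compares a quantity with its expectation, and only in the direction that the theorem
  uses.  Bounding the degree of the vertex \<open>0\<close> is enough to bound the minimal degree from above.
\<close>

definition concentrated :: "nat \<Rightarrow> real \<Rightarrow> real \<Rightarrow> nat ugraph set" where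
  "concentrated n p \<eta> = {G. verts G = {..<n} \<and>
     (\<forall>v<n. (1 - \<eta>) * ((real n - 1) * p) < degree G v) \<and>
     degree G 0 < (1 + \<eta>) * ((real n - 1) * p) \<and>
     (\<forall>S\<subseteq>{..<n}. card S = n div 2 \<longrightarrow>
        card (edge_boundary G S) < (1 + \<eta>) * (real (n div 2 * (n - n div 2)) * p))}"

text \<open>
  The union bound.  Its three terms account for the degrees that are too small, the degree of the
  vertex \<open>0\<close> being too large, and the bisections that are too large, of which there are at most as
  many as subsets of the vertex set.
\<close>

lemma prob_concentrated:
  fixes p \<eta> :: real
  assumes p: "0 \<le> p" "p \<le> 1" and n: "0 < n" and \<eta>: "0 < \<eta>" "\<eta> < 1"
  shows "measure_pmf.prob (random_graph n p) (concentrated n p \<eta>) \<ge> 1 -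
     (n * exp (- ((real n - 1) * p * rel_entropy (1 - \<eta>)))
      + exp (- ((real n - 1) * p * rel_entropy (1 + \<eta>)))
      + 2 ^ n * exp (- (real (n div 2 * (n - n div 2)) * p * rel_entropy (1 + \<eta>))))"
proof -
  let ?P = "measure_pmf.prob (random_graph n p)"
  define I where "I v = {e \<in> all_pairs {..<n}. v \<in> e}" for v
  define \<S> where "\<S> = {S. S \<subseteq> {..<n} \<and> card S = n div 2}"
  define B1 where "B1 v = {G :: nat ugraph. real (card (edges G \<inter> I v)) \<le> (1 - \<eta>) * (card (I v) * p)}" for v
  define B2 where "B2 = {G :: nat ugraph. (1 + \<eta>) * (card (I 0) * p) \<le> real (card (edges G \<inter> I 0))}"
  define B3 where "B3 S = {G :: nat ugraph. (1 + \<eta>) * (card (edge_boundary (complete_graph n) S) * p)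
      \<le> real (card (edges G \<inter> edge_boundary (complete_graph n) S))}" for S
  have fin: "finite \<S>" by (rule finite_subset[of _ "Pow {..<n}"]) (auto simp: \<S>_def)
  have cardS: "real (card \<S>) \<le> 2 ^ n"
  proof -
    have "card \<S> \<le> card (Pow {..<n})" by (rule card_mono) (auto simp: \<S>_def)
    hence "card \<S> \<le> 2 ^ n" by (simp add: card_Pow)
    thus ?thesis by (metis of_nat_le_iff of_nat_numeral of_nat_power)
  qed
  have cI: "card (I v) = n - 1" "real (card (I v)) = real n - 1" if "v < n" for v
    using card_incident_pairs[OF that] that by (auto simp: I_def of_nat_diff)
  have cB: "card (edge_boundary (complete_graph n) S) = n div 2 * (n - n div 2)" if "S \<in> \<S>" for S
    using that card_edge_boundary_complete_graph by (auto simp: \<S>_def)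
  have "?P (- concentrated n p \<eta>) = ?P (- concentrated n p \<eta> \<inter> set_pmf (random_graph n p))"
    by (simp add: measure_Int_set_pmf)
  also have "\<dots> \<le> ?P ((\<Union>v\<in>{..<n}. B1 v) \<union> B2 \<union> (\<Union>S\<in>\<S>. B3 S))"
  proof (rule measure_pmf.finite_measure_mono)
    show "- concentrated n p \<eta> \<inter> set_pmf (random_graph n p) \<subseteq> (\<Union>v\<in>{..<n}. B1 v) \<union> B2 \<union> (\<Union>S\<in>\<S>. B3 S)"
    proof (rule subsetI, rule ccontr)
      fix G assume G: "G \<in> - concentrated n p \<eta> \<inter> set_pmf (random_graph n p)"
        and good: "G \<notin> (\<Union>v\<in>{..<n}. B1 v) \<union> B2 \<union> (\<Union>S\<in>\<S>. B3 S)"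
      have V: "verts G = {..<n}" and E: "edges G \<subseteq> all_pairs {..<n}"
        using G random_graph_support[of G n p] by auto
      have deg: "degree G v = card (edges G \<inter> I v)" for v
        unfolding I_def by (rule degree_eq_edge_count[OF E])
      have "G \<in> concentrated n p \<eta>"
        unfolding concentrated_def
      proof (intro CollectI conjI allI impI)
        fix v assume v: "v < n"
        hence "G \<notin> B1 v" using good by auto
        thus "(1 - \<eta>) * ((real n - 1) * p) < degree G v" using cI[OF v] by (simp add: B1_def deg)
      next
        show "degree G 0 < (1 + \<eta>) * ((real n - 1) * p)"
          using good cI[OF n] by (simp add: B2_def deg)
      next
        fix S assume "S \<subseteq> {..<n}" "card S = n div 2"
        hence S: "S \<in> \<S>" by (simp add: \<S>_def)
        hence "G \<notin> B3 S" using good by auto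
        thus "card (edge_boundary G S) < (1 + \<eta>) * (real (n div 2 * (n - n div 2)) * p)"
          using cB[OF S] by (simp add: B3_def edge_boundary_eq_inter[OF E, of S])
      qed (rule V)
      with G show False by simp
    qed
  qed auto
  also have "\<dots> \<le> ?P (\<Union>v\<in>{..<n}. B1 v) + ?P B2 + ?P (\<Union>S\<in>\<S>. B3 S)"
    by (intro order_trans[OF measure_Un_le] add_mono order_refl) auto
  also have "\<dots> \<le> (\<Sum>v<n. ?P (B1 v)) + ?P B2 + (\<Sum>S\<in>\<S>. ?P (B3 S))"
    by (intro add_mono order_refl measure_UNION_le) (auto simp: fin)
  also have "\<dots> \<le> (\<Sum>v<n. exp (- ((real n - 1) * p * rel_entropy (1 - \<eta>))))
      + exp (- ((real n - 1) * p * rel_entropy (1 + \<eta>)))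
      + (\<Sum>S\<in>\<S>. exp (- (real (n div 2 * (n - n div 2)) * p * rel_entropy (1 + \<eta>))))"
  proof (intro add_mono sum_mono)
    fix v assume "v \<in> {..<n}"
    thus "?P (B1 v) \<le> exp (- ((real n - 1) * p * rel_entropy (1 - \<eta>)))"
      using prob_edge_count_le[OF p, of "I v" n "1 - \<eta>"] \<eta> cI[of v] by (auto simp: B1_def I_def)
  next
    show "?P B2 \<le> exp (- ((real n - 1) * p * rel_entropy (1 + \<eta>)))"
      using prob_edge_count_ge[OF p, of "I 0" n "1 + \<eta>"] \<eta> cI[OF n] by (auto simp: B2_def I_def)
  next
    fix S assume S: "S \<in> \<S>"
    have "edge_boundary (complete_graph n) S \<subseteq> all_pairs {..<n}" by (auto simp: edge_boundary_def)
    thus "?P (B3 S) \<le> exp (- (real (n div 2 * (n - n div 2)) * p * rel_entropy (1 + \<eta>)))"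
      using prob_edge_count_ge[OF p, of "edge_boundary (complete_graph n) S" n "1 + \<eta>"] \<eta> cB[OF S]
      by (simp add: B3_def)
  qed
  also have "\<dots> \<le> n * exp (- ((real n - 1) * p * rel_entropy (1 - \<eta>)))
      + exp (- ((real n - 1) * p * rel_entropy (1 + \<eta>)))
      + 2 ^ n * exp (- (real (n div 2 * (n - n div 2)) * p * rel_entropy (1 + \<eta>)))"
    using cardS by (simp add: mult_right_mono del: of_nat_mult of_nat_diff)
  finally show ?thesis
    using measure_pmf.prob_compl[of "concentrated n p \<eta>" "random_graph n p"] by (simp add: Compl_eq_Diff_UNIV)
qed

section \<open>Concentrated graphs\<close>

lemma isoperimetric_constant_le:
  assumes "finite (verts G)" "S \<noteq> {}" "S \<subset> verts G" "real (card S) \<le> real (card (verts G)) / 2"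
  shows "isoperimetric_constant G \<le> real (card (edge_boundary G S)) / real (card S)"
  unfolding isoperimetric_constant_def
proof (rule Min_le)
  show "finite {real (card (edge_boundary G S)) / real (card S) | S.
            S \<noteq> {} \<and> S \<subset> verts G \<and> real (card S) \<le> real (card (verts G)) / 2}"
    by (rule finite_subset[of _ "(\<lambda>S. real (card (edge_boundary G S)) / real (card S)) ` Pow (verts G)"])
       (use assms in auto)
qed (use assms in blast)

lemma concentrated_min_degree:
  assumes "G \<in> concentrated n p \<eta>" "0 < n"
  shows "(1 - \<eta>) * ((real n - 1) * p) < min_degree G" "min_degree G < (1 + \<eta>) * ((real n - 1) * p)"
proof -
  have fin: "finite (degree G ` verts G)" and V: "verts G = {..<n}"
    using assms by (auto simp: concentrated_def)
  have "min_degree G \<in> degree G ` verts G"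
    unfolding min_degree_def using fin V assms(2) by (intro Min_in) auto
  thus "(1 - \<eta>) * ((real n - 1) * p) < min_degree G" using assms by (auto simp: concentrated_def)
  have "min_degree G \<le> degree G 0"
    unfolding min_degree_def using fin V assms(2) by (intro Min_le) auto
  thus "min_degree G < (1 + \<eta>) * ((real n - 1) * p)" using assms by (auto simp: concentrated_def)
qed

text \<open>
  Dividing the bound on the boundary by the size of \<open>S\<close> leaves \<open>(1 + \<eta>) p\<close> times the size of the
  complement of \<open>S\<close>, about \<open>(1 + \<eta>) n p / 2\<close>, to be compared with \<open>a (1 - \<eta>) n p\<close>.  The common
  factor \<open>p\<close> cancels, which leaves the condition \<open>gap\<close>.
\<close>

lemma concentrated_bisection:
  fixes p \<eta> a :: real
  assumes G: "G \<in> concentrated n p \<eta>" and n: "2 \<le> n" and p: "0 \<le> p" and a: "0 \<le> a"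
    and gap: "(1 + \<eta>) * real (n - n div 2) \<le> a * ((1 - \<eta>) * (real n - 1))"
    and S: "S \<subseteq> {..<n}" "card S = n div 2"
  shows "card (edge_boundary G S) / card S < a * min_degree G"
proof -
  have k: "0 < real (n div 2)" using n by simp
  have "card (edge_boundary G S) < (1 + \<eta>) * (real (n div 2 * (n - n div 2)) * p)"
    using G S by (auto simp: concentrated_def)
  hence "card (edge_boundary G S) / card S < (1 + \<eta>) * real (n - n div 2) * p"
    using k S(2) by (simp add: divide_less_eq del: of_nat_diff) (simp add: mult_ac del: of_nat_diff)
  also have "\<dots> \<le> a * ((1 - \<eta>) * (real n - 1)) * p" using gap p by (rule mult_right_mono)
  also have "\<dots> = a * ((1 - \<eta>) * ((real n - 1) * p))" by simp
  also have "\<dots> \<le> a * min_degree G"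
    using concentrated_min_degree(1)[OF G] n a by (intro mult_left_mono) auto
  finally show ?thesis .
qed

section \<open>Sparse random graphs above the connectivity threshold\<close>

text \<open>
  The first term is about \<open>n powr (1 - C h\<^sub>1)\<close>, so that \<open>C h\<^sub>1 > 1\<close> is needed, while the last one is
  at most \<open>exp (n (ln 2 - c ln n))\<close> with some \<open>c > 0\<close>, which tends to \<open>0\<close> for any positive \<open>C h\<^sub>2\<close>.
\<close>

lemma failure_bound_tendsto_0:
  fixes C h\<^sub>1 h\<^sub>2 :: real
  assumes "1 < C * h\<^sub>1" "0 < C" "0 < h\<^sub>2"
  shows "(\<lambda>n. real n * exp (- ((real n - 1) * (C * ln n / n) * h\<^sub>1))
      + exp (- ((real n - 1) * (C * ln n / n) * h\<^sub>2))
      + 2 ^ n * exp (- (real (n div 2 * (n - n div 2)) * (C * ln n / n) * h\<^sub>2))) \<longlonglongrightarrow> 0"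
proof -
  define a where "a = C * h\<^sub>1"
  define b where "b = C * h\<^sub>2"
  have a: "1 < a" and b: "0 < b" using assms by (simp_all add: a_def b_def)
  have "(\<lambda>n. real n * exp (- ((real n - 1) * (ln n / n) * a))) \<longlonglongrightarrow> 0"
    using a by real_asymp
  moreover have "(\<lambda>n. exp (- ((real n - 1) * (ln n / n) * b))) \<longlonglongrightarrow> 0"
    using b by real_asymp
  moreover have "(\<lambda>n. 2 ^ n * exp (- (real (n div 2 * (n - n div 2)) * (ln n / n) * b))) \<longlonglongrightarrow> 0"
  proof (rule tendsto_sandwich[OF _ _ tendsto_const])
    \<comment> \<open>A crude lower bound for the number of pairs across a bisection, free of the floor function.\<close>
    show "(\<lambda>n. 2 ^ n * exp (- (n\<^sup>2 / 8 * (ln n / n) * b))) \<longlonglongrightarrow> (0::real)"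
      using b by real_asymp
    show "\<forall>\<^sub>F n in sequentially. 2 ^ n * exp (- (real (n div 2 * (n - n div 2)) * (ln n / n) * b))
        \<le> 2 ^ n * exp (- (n\<^sup>2 / 8 * (ln n / n) * b))"
      using eventually_ge_at_top[of 2]
    proof eventually_elim
      case (elim n)
      have "n / 4 \<le> real (n div 2)" "n / 2 \<le> real (n - n div 2)" using elim by linarith+
      hence "n / 4 * (n / 2) \<le> real (n div 2) * real (n - n div 2)" by (intro mult_mono) auto
      hence "n\<^sup>2 / 8 \<le> real (n div 2 * (n - n div 2))" by (simp add: power2_eq_square)
      hence "n\<^sup>2 / 8 * (ln n / n) * b \<le> real (n div 2 * (n - n div 2)) * (ln n / n) * b"
        using b elim by (intro mult_right_mono) auto
      thus ?case by (intro mult_left_mono) auto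
    qed
  qed auto
  ultimately have "(\<lambda>n. real n * exp (- ((real n - 1) * (ln n / n) * a))
      + exp (- ((real n - 1) * (ln n / n) * b))
      + 2 ^ n * exp (- (real (n div 2 * (n - n div 2)) * (ln n / n) * b))) \<longlonglongrightarrow> 0"
    by (intro tendsto_add_zero)
  moreover have "x * (C * y / z) * h = x * (y / z) * (C * h)" for x y z h :: real by simp
  ultimately show ?thesis unfolding a_def b_def by (simp only:)
qed

theorem theorem1p2:
  fixes \<epsilon> :: real
  assumes "0 < \<epsilon>" and "\<epsilon> < 1 / 2"
  shows "\<exists>C>0.
    (\<exists>a>0. \<exists>b>0.
      (\<lambda>n::nat. measure_pmf.prob (random_graph n (C * ln (real n) / real n))
         {G. isoperimetric_constant G \<le> (1 / 2 + \<epsilon>) * real (min_degree G) \<and>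
             a * ln (real n) \<le> (1 / 2 + \<epsilon>) * real (min_degree G) \<and>
             (1 / 2 + \<epsilon>) * real (min_degree G) \<le> b * ln (real n)})
        \<longlonglongrightarrow> 1) \<and>
    (\<lambda>n::nat. measure_pmf.prob (random_graph n (C * ln (real n) / real n))
       {G. \<forall>S. S \<subseteq> verts G \<and> card S = nat \<lfloor>real n / 2\<rfloor> \<longrightarrow>
             real (card (edge_boundary G S)) / real (card S)
               < (1 / 2 + \<epsilon>) * real (min_degree G)})
      \<longlonglongrightarrow> 1"
proof -
  \<comment> \<open>The choice of \<open>\<eta>\<close> has to satisfy \<open>(1 + \<eta>) / 2 < (1 / 2 + \<epsilon>) (1 - \<eta>)\<close>.  For \<open>\<eta> = \<epsilon> / 2\<close>
    the two sides differ by \<open>\<epsilon> (1 - \<epsilon>) / 2\<close>.\<close>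
  define \<eta> where "\<eta> = \<epsilon> / 2"
  define \<beta> where "\<beta> = 1 / 2 + \<epsilon>"
  have \<eta>: "0 < \<eta>" "\<eta> < 1" and \<beta>: "0 < \<beta>" using assms by (auto simp: \<eta>_def \<beta>_def)
  have h: "0 < rel_entropy (1 - \<eta>)" "0 < rel_entropy (1 + \<eta>)"
    using \<eta> by (auto intro!: rel_entropy_pos)
  \<comment> \<open>The numerator could be any number greater than \<open>1\<close>.\<close>
  define C where "C = 2 / rel_entropy (1 - \<eta>)"
  have C: "0 < C" "1 < C * rel_entropy (1 - \<eta>)" using h by (auto simp: C_def)
  \<comment> \<open>The factor \<open>1 / 2\<close> absorbs the difference between the mean degree \<open>(n - 1) p\<close> and \<open>n p\<close>.\<close>
  define a where "a = \<beta> * ((1 - \<eta>) * C / 2)"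
  define b where "b = \<beta> * ((1 + \<eta>) * C)"
  have ab: "0 < a" "0 < b" using \<eta> \<beta> C by (auto simp: a_def b_def)
  define p where "p n = C * ln (real n) / real n" for n :: nat
  define Iso where "Iso n = {G :: nat ugraph. isoperimetric_constant G \<le> \<beta> * real (min_degree G) \<and>
             a * ln (real n) \<le> \<beta> * real (min_degree G) \<and>
             \<beta> * real (min_degree G) \<le> b * ln (real n)}" for n
  define Bis where "Bis n = {G :: nat ugraph. \<forall>S. S \<subseteq> verts G \<and> card S = nat \<lfloor>real n / 2\<rfloor> \<longrightarrow>
             real (card (edge_boundary G S)) / real (card S) < \<beta> * real (min_degree G)}" for n :: nat
  define r where "r n = real n * exp (- ((real n - 1) * p n * rel_entropy (1 - \<eta>)))
      + exp (- ((real n - 1) * p n * rel_entropy (1 + \<eta>)))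
      + 2 ^ n * exp (- (real (n div 2 * (n - n div 2)) * p n * rel_entropy (1 + \<eta>)))" for n
  have r: "r \<longlonglongrightarrow> 0"
    unfolding r_def p_def using C h by (intro failure_bound_tendsto_0)

  have "\<forall>\<^sub>F n in sequentially. p n \<le> 1" unfolding p_def using C by real_asymp
  moreover have "\<forall>\<^sub>F n in sequentially. (1 + \<eta>) * ((real n + 1) / 2) \<le> \<beta> * ((1 - \<eta>) * (real n - 1))"
  proof -
    have "\<epsilon> * \<epsilon> < \<epsilon> * (1 / 2)" using assms by (intro mult_strict_left_mono)
    moreover have "\<beta> * (1 - \<eta>) - (1 + \<eta>) / 2 = \<epsilon> / 2 - \<epsilon> * \<epsilon> / 2"
      by (simp add: \<eta>_def \<beta>_def field_simps)
    ultimately have "(1 + \<eta>) / 2 < \<beta> * (1 - \<eta>)" using assms by linarith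
    then obtain d where d: "\<beta> * (1 - \<eta>) = (1 + \<eta>) / 2 + d" "0 < d"
      by (metis add.commute diff_add_cancel diff_gt_0_iff_gt)
    have "\<forall>\<^sub>F n in sequentially. (1 + \<eta>) * ((real n + 1) / 2) \<le> ((1 + \<eta>) / 2 + d) * (real n - 1)"
      using d \<eta> by real_asymp
    thus ?thesis by (simp add: d(1) [symmetric] mult.assoc)
  qed
  ultimately have good: "\<forall>\<^sub>F n in sequentially. concentrated n (p n) \<eta> \<subseteq> Iso n \<inter> Bis n \<and>
      1 - r n \<le> measure_pmf.prob (random_graph n (p n)) (concentrated n (p n) \<eta>)"
    using eventually_ge_at_top[of 2]
  proof eventually_elim
    case (elim n)
    have p: "0 \<le> p n" using elim C by (simp add: p_def)
    have half: "nat \<lfloor>real n / 2\<rfloor> = n div 2" by linarith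
    have "2 * (n - n div 2) \<le> n + 1" by presburger
    hence "real (2 * (n - n div 2)) \<le> real (n + 1)" by (rule of_nat_mono)
    hence "real (n - n div 2) \<le> (real n + 1) / 2" by (simp del: of_nat_diff)
    hence "(1 + \<eta>) * real (n - n div 2) \<le> (1 + \<eta>) * ((real n + 1) / 2)"
      using \<eta> by (intro mult_left_mono) auto
    hence gap: "(1 + \<eta>) * real (n - n div 2) \<le> \<beta> * ((1 - \<eta>) * (real n - 1))"
      using elim by linarith
    have mean: "C / 2 * ln n \<le> (real n - 1) * p n" "(real n - 1) * p n \<le> C * ln n"
    proof -
      have "1 / 2 * (C * ln n) \<le> (real n - 1) / n * (C * ln n)"
        "(real n - 1) / n * (C * ln n) \<le> 1 * (C * ln n)"
        using elim C by (intro mult_right_mono; simp add: field_simps)+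
      thus "C / 2 * ln n \<le> (real n - 1) * p n" "(real n - 1) * p n \<le> C * ln n"
        by (simp_all add: p_def)
    qed
    have "G \<in> Iso n \<inter> Bis n" if G: "G \<in> concentrated n (p n) \<eta>" for G
    proof -
      have V: "verts G = {..<n}" using G by (simp add: concentrated_def)
      have bis: "card (edge_boundary G S) / card S < \<beta> * min_degree G"
        if "S \<subseteq> {..<n}" "card S = n div 2" for S
        using G p \<beta> gap elim that by (intro concentrated_bisection[of _ n "p n" \<eta>]) auto
      have "isoperimetric_constant G \<le> card (edge_boundary G {..<n div 2}) / card {..<n div 2}"
      proof (rule isoperimetric_constant_le)
        show "{..<n div 2} \<subset> verts G" using elim by (simp add: V lessThan_strict_subset_iff)
        show "{..<n div 2} \<noteq> {}" using elim by (simp add: lessThan_empty_iff)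
      qed (auto simp: V)
      also have "\<dots> < \<beta> * min_degree G" by (rule bis) auto
      finally have iso: "isoperimetric_constant G \<le> \<beta> * min_degree G" by simp
      have "(1 - \<eta>) * (C / 2 * ln n) \<le> (1 - \<eta>) * ((real n - 1) * p n)"
        using mean \<eta> by (intro mult_left_mono) auto
      also have "\<dots> \<le> min_degree G" using concentrated_min_degree(1)[OF G] elim by simp
      finally have "\<beta> * ((1 - \<eta>) * (C / 2 * ln n)) \<le> \<beta> * min_degree G"
        using \<beta> by (intro mult_left_mono) auto
      hence lower: "a * ln n \<le> \<beta> * min_degree G" by (simp add: a_def)
      have "min_degree G \<le> (1 + \<eta>) * ((real n - 1) * p n)"
        using concentrated_min_degree(2)[OF G] elim by simp
      also have "\<dots> \<le> (1 + \<eta>) * (C * ln n)"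
        using mean \<eta> by (intro mult_left_mono) auto
      finally have "\<beta> * min_degree G \<le> \<beta> * ((1 + \<eta>) * (C * ln n))"
        using \<beta> by (intro mult_left_mono) auto
      hence upper: "\<beta> * min_degree G \<le> b * ln n" by (simp add: b_def mult.assoc)
      show ?thesis using iso lower upper bis by (auto simp: Iso_def Bis_def V half)
    qed
    moreover have "1 - r n \<le> measure_pmf.prob (random_graph n (p n)) (concentrated n (p n) \<eta>)"
      unfolding r_def using p elim \<eta> by (intro prob_concentrated) auto
    ultimately show ?case by blast
  qed
  have whp: "(\<lambda>n. measure_pmf.prob (random_graph n (p n)) (E n)) \<longlonglongrightarrow> 1"
    if E: "\<And>n. Iso n \<inter> Bis n \<subseteq> E n" for E
  proof (rule tendsto_sandwich[OF _ _ _ tendsto_const])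
    show "(\<lambda>n. 1 - r n) \<longlonglongrightarrow> 1" using tendsto_diff[OF tendsto_const[of 1] r] by simp
    show "\<forall>\<^sub>F n in sequentially. 1 - r n \<le> measure_pmf.prob (random_graph n (p n)) (E n)"
      using good
    proof eventually_elim
      case (elim n)
      have "measure_pmf.prob (random_graph n (p n)) (concentrated n (p n) \<eta>)
          \<le> measure_pmf.prob (random_graph n (p n)) (E n)"
        using elim E[of n] by (intro measure_pmf.finite_measure_mono) auto
      thus ?case using elim by linarith
    qed
  qed auto
  show ?thesis
    using C(1) ab whp[of Iso] whp[of Bis] unfolding Iso_def Bis_def p_def \<beta>_def
    by (intro exI[of _ C] exI[of _ a] exI[of _ b] conjI) auto
qed

end
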